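(* Let $s,t\ge 1$ and $r\ge 3$ be integers with $r<s+t$, and let $G=K_s\,\dot\cup\,K_t$ be the disjoint union of complete graphs of orders $s$ and $t$. Then $G$ is $r$-neutral if $r$ is even, $G$ is $r$-void if $r\equiv 1\pmod 4$, and $G$ is $r$-complete if $r\equiv 3\pmod 4$.
   Context: For a graph $G$ of order $n$ and an integer $r$ with $2<r\le n$: $G$ is called $r$-complete if every subgraph of $G$ induced by $r$ vertices has an odd number of edges; $r$-void if every subgraph induced by $r$ vertices has an even number of edges; and $r$-neutral if it is neither $r$-complete nor $r$-void. *)

theory Defs
  imports "HOL-Library.Ramsey" "HOL-Number_Theory.Cong"
begin

text \<open>Edges are two-element vertex sets; \<open>[V]\<^bsup>2\<^esup>\<close> is the library's \<^const>\<open>nsets\<close>.\<close>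

record 'a ugraph =
  verts :: "'a set"
  edges :: "'a set set"

definition simple_graph :: "'a ugraph \<Rightarrow> bool" where
  "simple_graph G \<longleftrightarrow> finite (verts G) \<and> edges G \<subseteq> [verts G]\<^bsup>2\<^esup>"

definition graph_order :: "'a ugraph \<Rightarrow> nat" where
  "graph_order G = card (verts G)"

definition induced_subgraph :: "'a ugraph \<Rightarrow> 'a set \<Rightarrow> 'a ugraph" where
  "induced_subgraph G S = \<lparr>verts = S, edges = {e \<in> edges G. e \<subseteq> S}\<rparr>"

definition num_edges :: "'a ugraph \<Rightarrow> nat" where
  "num_edges G = card (edges G)"

text \<open>\<open>is_complete_graph n G\<close>: \<open>G\<close> is a copy of \<open>K\<^sub>n\<close>, on an arbitrary vertex set of size \<open>n\<close>.\<close>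

definition is_complete_graph :: "nat \<Rightarrow> 'a ugraph \<Rightarrow> bool" where
  "is_complete_graph n G \<longleftrightarrow>
     simple_graph G \<and> graph_order G = n \<and> edges G = [verts G]\<^bsup>2\<^esup>"

definition is_disjoint_union :: "'a ugraph \<Rightarrow> 'a ugraph \<Rightarrow> 'a ugraph \<Rightarrow> bool" where
  "is_disjoint_union G H K \<longleftrightarrow> verts H \<inter> verts K = {} \<and>
     verts G = verts H \<union> verts K \<and> edges G = edges H \<union> edges K"

text \<open>The three parity notions are only meaningful for \<open>2 < r \<le> n\<close> with \<open>n\<close> the order of the
  graph; each of them includes this side condition.\<close>

definition r_complete :: "nat \<Rightarrow> 'a ugraph \<Rightarrow> bool" where
  "r_complete r G \<longleftrightarrow> 2 < r \<and> r \<le> graph_order G \<and>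
     (\<forall>S\<in>[verts G]\<^bsup>r\<^esup>. odd (num_edges (induced_subgraph G S)))"

definition r_void :: "nat \<Rightarrow> 'a ugraph \<Rightarrow> bool" where
  "r_void r G \<longleftrightarrow> 2 < r \<and> r \<le> graph_order G \<and>
     (\<forall>S\<in>[verts G]\<^bsup>r\<^esup>. even (num_edges (induced_subgraph G S)))"

definition r_neutral :: "nat \<Rightarrow> 'a ugraph \<Rightarrow> bool" where
  "r_neutral r G \<longleftrightarrow> 2 < r \<and> r \<le> graph_order G \<and> \<not> r_complete r G \<and> \<not> r_void r G"

lemma simple_graph_disjoint_union:
  assumes "simple_graph H" "simple_graph K" "is_disjoint_union G H K"
  shows "simple_graph G"
  using assms unfolding simple_graph_def is_disjoint_union_def nsets_def by auto

lemma simple_graph_induced_subgraph: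
  assumes "simple_graph G" "S \<subseteq> verts G"
  shows "simple_graph (induced_subgraph G S)"
  using assms unfolding simple_graph_def induced_subgraph_def nsets_def
  by (auto intro: finite_subset)

end

theory Submission
  imports Defs
begin

text \<open>An \<open>r\<close>-set meeting the two cliques in \<open>a\<close> and \<open>b = r - a\<close> vertices induces
  \<open>(r choose 2) - a b\<close> edges. For odd \<open>r\<close> the product \<open>a b\<close> is even, so the parity is that of
  \<open>(r choose 2)\<close>. For even \<open>r\<close> the product has the parity of \<open>a\<close>, and \<open>r < s + t\<close> leaves room
  for two consecutive values of \<open>a\<close>.\<close>

text \<open>Vandermonde's identity in degree two: \<open>a * b\<close> counts the pairs that cross
  between the two parts.\<close>

lemma choose_two_add: "(a + b) choose 2 = (a choose 2) + (b choose 2) + a * b"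
  by (induction a) (auto simp: numeral_2_eq_2)

lemma even_choose_two_if_cong_1:
  assumes "[r = 1] (mod 4)"
  shows "even (r choose 2)"
proof -
  have "r mod 4 = 1"
    using assms by (simp add: cong_def)
  then obtain q where "r = 4 * q + 1"
    by (metis mult_div_mod_eq)
  then have "r choose 2 = 2 * (q * (4 * q + 1))"
    by (simp add: choose_two algebra_simps)
  then show ?thesis
    by simp
qed

lemma odd_choose_two_if_cong_3:
  assumes "[r = 3] (mod 4)"
  shows "odd (r choose 2)"
proof -
  have "r mod 4 = 3"
    using assms by (simp add: cong_def)
  then obtain q where "r = 4 * q + 3"
    by (metis mult_div_mod_eq)
  \<comment> \<open>\<open>choose_two\<close> divides by two, so the product is first exhibited as
    an explicit double, using \<open>r - 1 = 2 * (2 * q + 1)\<close>; the cofactor is a product of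
    two odd numbers.\<close>
  then have "r * (r - 1) = 2 * ((4 * q + 3) * (2 * q + 1))"
    by (simp add: algebra_simps)
  then have "r choose 2 = (4 * q + 3) * (2 * q + 1)"
    by (simp add: choose_two)
  then show ?thesis
    by simp
qed

text \<open>The only pairs in \<open>S\<close> that are not edges are those crossing between the
  cliques. The additive form avoids truncated subtraction and lets parity pass through
  \<open>even_add\<close>; the bound makes \<open>r - card (S \<inter> verts Ks)\<close> a genuine
  difference.\<close>

lemma num_edges_induced_subgraph_two_cliques:
  assumes "is_complete_graph s Ks" and "is_complete_graph t Kt"
    and "is_disjoint_union G Ks Kt" and "S \<in> [verts G]\<^bsup>r\<^esup>"
  shows "num_edges (induced_subgraph G S) +
           card (S \<inter> verts Ks) * (r - card (S \<inter> verts Ks)) = r choose 2"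
    and "card (S \<inter> verts Ks) \<le> r"
proof -
  define A where "A = S \<inter> verts Ks"
  define B where "B = S \<inter> verts Kt"
  have S: "S \<subseteq> verts G" "finite S" "card S = r"
    using assms(4) by (auto simp: nsets_def)
  have disj: "A \<inter> B = {}" and S_eq: "S = A \<union> B" and fin: "finite A" "finite B"
    using S assms(3) by (auto simp: A_def B_def is_disjoint_union_def)
  then have r: "card A + card B = r"
    using S(3) card_Un_disjoint by metis
  \<comment> \<open>Every edge of \<open>G\<close> lies within one clique, so an edge inside
    \<open>S\<close> lies inside \<open>A\<close> or inside \<open>B\<close>; completeness gives the
    converse inclusion.\<close>
  have "{e \<in> edges G. e \<subseteq> S} = [A]\<^bsup>2\<^esup> \<union> [B]\<^bsup>2\<^esup>"
    using assms(1-3)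
    by (auto simp: is_complete_graph_def is_disjoint_union_def nsets_def A_def B_def)
  moreover have "[A]\<^bsup>2\<^esup> \<inter> [B]\<^bsup>2\<^esup> = {}"
  proof -
    have False if "e \<subseteq> A" "e \<subseteq> B" "card e = 2" for e
    proof -
      have "e = {}"
        using that disj by blast
      then show False
        using that by simp
    qed
    then show ?thesis
      by (auto simp: nsets_def)
  qed
  ultimately have "num_edges (induced_subgraph G S) = (card A choose 2) + (card B choose 2)"
    using fin by (simp add: num_edges_def induced_subgraph_def card_Un_disjoint finite_imp_finite_nsets)
  then show "num_edges (induced_subgraph G S) +
      card (S \<inter> verts Ks) * (r - card (S \<inter> verts Ks)) = r choose 2"
    using choose_two_add[of "card A" "card B"] r by (auto simp flip: A_def)
  show "card (S \<inter> verts Ks) \<le> r"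
    using r by (simp flip: A_def)
qed

text \<open>Supplies the witnesses for even \<open>r\<close>: take \<open>k\<close> elements of
  \<open>A\<close> and fill up with \<open>r - k\<close> elements of \<open>B\<close>. Because
  \<open>k \<le> r\<close>, the two sizes add up to \<open>r\<close>.\<close>

lemma ex_nset_card_Int_eq:
  assumes "finite A" and "finite B" and "A \<inter> B = {}"
    and "k \<le> card A" and "k \<le> r" and "r - k \<le> card B"
  obtains S where "S \<in> [A \<union> B]\<^bsup>r\<^esup>" and "card (S \<inter> A) = k"
proof -
  obtain X where X: "X \<subseteq> A" "card X = k" "finite X"
    using assms(4) by (meson obtain_subset_with_card_n)
  obtain Y where Y: "Y \<subseteq> B" "card Y = r - k" "finite Y"
    using assms(6) by (meson obtain_subset_with_card_n)
  have "X \<inter> Y = {}"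
    using X Y assms(3) by blast
  then have "card (X \<union> Y) = r"
    using X Y assms(5) by (simp add: card_Un_disjoint)
  then have "X \<union> Y \<in> [A \<union> B]\<^bsup>r\<^esup>"
    using X Y by (auto simp: nsets_def)
  moreover have "(X \<union> Y) \<inter> A = X"
    using X Y assms(3) by blast
  ultimately show thesis
    using that X(2) by metis
qed

theorem theorem10:
  fixes s t r :: nat and Ks Kt G :: "'a ugraph"
  assumes "s \<ge> 1" and "t \<ge> 1" and "r \<ge> 3" and "r < s + t"
    and "is_complete_graph s Ks" and "is_complete_graph t Kt"
    and "is_disjoint_union G Ks Kt"
  shows "(even r \<longrightarrow> r_neutral r G) \<and>
         ([r = 1] (mod 4) \<longrightarrow> r_void r G) \<and>
         ([r = 3] (mod 4) \<longrightarrow> r_complete r G)"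
proof -
  note edges = num_edges_induced_subgraph_two_cliques[OF assms(5-7)]
  have fin: "finite (verts Ks)" "finite (verts Kt)"
    and card: "card (verts Ks) = s" "card (verts Kt) = t"
    using assms(5,6) by (auto simp: is_complete_graph_def simple_graph_def graph_order_def)
  have disj: "verts Ks \<inter> verts Kt = {}" and verts: "verts G = verts Ks \<union> verts Kt"
    using assms(7) by (auto simp: is_disjoint_union_def)
  have r: "2 < r" "r \<le> graph_order G"
    using assms(3,4) fin card disj verts by (auto simp: graph_order_def card_Un_disjoint)
  have odd_r: "even (num_edges (induced_subgraph G S)) \<longleftrightarrow> even (r choose 2)"
    if "odd r" "S \<in> [verts G]\<^bsup>r\<^esup>" for S
  proof -
    \<comment> \<open>The factors sum to the odd number \<open>r\<close>, so one of them is
      even.\<close>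
    have "even (card (S \<inter> verts Ks) * (r - card (S \<inter> verts Ks)))"
      using that(1) edges(2)[OF that(2)] by auto
    then show ?thesis
      using edges(1)[OF that(2)] by (metis even_add)
  qed
  have void: "r_void r G" if "[r = 1] (mod 4)"
  proof -
    have "r mod 4 = 1"
      using that by (simp add: cong_def)
    then have "odd r"
      by presburger
    then show ?thesis
      using r odd_r even_choose_two_if_cong_1[OF that] by (simp add: r_void_def)
  qed
  have complete: "r_complete r G" if "[r = 3] (mod 4)"
  proof -
    have "r mod 4 = 3"
      using that by (simp add: cong_def)
    then have "odd r"
      by presburger
    then show ?thesis
      using r odd_r odd_choose_two_if_cong_3[OF that] by (simp add: r_complete_def)
  qed
  have neutral: "r_neutral r G" if "even r"
  proof -
    have parity: "even (num_edges (induced_subgraph G S)) \<longleftrightarrow>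
        (even (r choose 2) \<longleftrightarrow> even (card (S \<inter> verts Ks)))"
      if "S \<in> [verts G]\<^bsup>r\<^esup>" for S
    proof -
      \<comment> \<open>The factors sum to the even number \<open>r\<close>, so they have the same
        parity.\<close>
      have "even (card (S \<inter> verts Ks) * (r - card (S \<inter> verts Ks))) \<longleftrightarrow> even (card (S \<inter> verts Ks))"
        using \<open>even r\<close> edges(2)[OF that] by auto
      then show ?thesis
        using edges(1)[OF that] by (metis even_add)
    qed
    \<comment> \<open>The fewest vertices of \<open>Ks\<close> that an \<open>r\<close>-set can
      contain; truncation gives 0 when \<open>r \<le> t\<close>. Then \<open>Suc k \<le> s\<close>
      follows from \<open>s \<ge> 1\<close> if \<open>r \<le> t\<close> and from
      \<open>r < s + t\<close> otherwise.\<close>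
    define k where "k = r - t"
    have k: "k \<le> s" "k \<le> r" "r - k \<le> t" "Suc k \<le> s" "Suc k \<le> r" "r - Suc k \<le> t"
      using assms(1-4) by (auto simp: k_def)
    obtain S where S: "S \<in> [verts G]\<^bsup>r\<^esup>" "card (S \<inter> verts Ks) = k"
      using ex_nset_card_Int_eq[OF fin disj, of k r] k card verts by metis
    obtain T where T: "T \<in> [verts G]\<^bsup>r\<^esup>" "card (T \<inter> verts Ks) = Suc k"
      using ex_nset_card_Int_eq[OF fin disj, of "Suc k" r] k card verts by metis
    \<comment> \<open>Since \<open>k\<close> and \<open>Suc k\<close> differ in parity, one of
      \<open>S\<close> and \<open>T\<close> refutes \<open>r_complete\<close> and the other refutes
      \<open>r_void\<close>.\<close>
    have "even (num_edges (induced_subgraph G S)) \<longleftrightarrow> odd (num_edges (induced_subgraph G T))"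
      using parity[OF S(1)] parity[OF T(1)] S(2) T(2) by auto
    then show ?thesis
      using r S(1) T(1) unfolding r_neutral_def r_complete_def r_void_def by blast
  qed
  show ?thesis
    using void complete neutral by blast
qed

end
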